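(* For every dimension $d$ and every real number $\alpha>0$ there exists $\beta>0$ such that the following holds. Let $P$ be a monotone property of boxes, and let $\mathcal{B}$ be a finite family of boxes in $\mathbb{R}^d$. If at least $\alpha\binom{|\mathcal{B}|}{d+1}$ of the $(d+1)$-tuples (subfamilies of size $d+1$) in $\mathcal{B}$ are $P$-intersecting, then there exists a $P$-intersecting subfamily $\mathcal{B}'\subseteq\mathcal{B}$ of size at least $\beta|\mathcal{B}|$.
   Context: A box in $\mathbb{R}^d$ is an axis-parallel box, i.e. a set of the form $[a_1,b_1]\times\cdots\times[a_d,b_d]$ (an intersection of $2d$ closed coordinate halfspaces, one for each direction $\pm e_i$); degenerate boxes and the empty set are allowed, so that an intersection of boxes is a box. A property $P$ of boxes (a class of boxes) is monotone if $B\in P$ and $B\subseteq C$ imply $C\in P$ for all boxes $B,C$. A family of boxes is $P$-intersecting if the intersection of its members has property $P$.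
   Formalization: The family is assumed to have at least d+1 boxes; for smaller non-empty families the binomial coefficient is 0, the density condition is void, and the claim fails (a single box, with P the property that no box has). *)

theory Defs
  imports "HOL-Analysis.Analysis"
begin

text \<open>
  \<^term>\<open>cbox a b\<close> is the product of the intervals \<open>[a\<^sub>i, b\<^sub>i]\<close>; it is degenerate when some
  \<open>a\<^sub>i = b\<^sub>i\<close> and empty when some \<open>b\<^sub>i < a\<^sub>i\<close>.
\<close>
definition is_box :: "(real ^ 'n) set \<Rightarrow> bool" where
  "is_box C \<longleftrightarrow> (\<exists>a b. C = cbox a b)"

text \<open>
  A property of boxes is a predicate on sets of which only the values on boxes matter.
\<close>
definition monotone_box_property :: "((real ^ 'n) set \<Rightarrow> bool) \<Rightarrow> bool" where
  "monotone_box_property P \<longleftrightarrow>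
     (\<forall>C D. is_box C \<longrightarrow> is_box D \<longrightarrow> P C \<longrightarrow> C \<subseteq> D \<longrightarrow> P D)"

text \<open>
  Families are indexed, so repeated members are allowed and are counted with multiplicity; a
  subfamily is given by a subset of the index set. For \<open>J = {}\<close> the intersection is the whole
  space, which is not a box, so this notion is only meaningful for nonempty \<open>J\<close>.
\<close>
definition P_intersecting ::
    "((real ^ 'n) set \<Rightarrow> bool) \<Rightarrow> ('i \<Rightarrow> (real ^ 'n) set) \<Rightarrow> 'i set \<Rightarrow> bool" where
  "P_intersecting P B J \<longleftrightarrow> P (\<Inter>i\<in>J. B i)"

end

theory Submission
  imports Defs
begin

text \<open>
  A box is cut out by one halfspace in each of the \<open>2 d\<close> signed coordinate directions.  Let \<open>T\<close> be
  a \<open>P\<close>-intersecting \<open>(d + 1)\<close>-tuple and mark, for every direction, one member of \<open>T\<close> that is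
  most restrictive in that direction.  Since \<open>2 d < 2 (d + 1)\<close>, some member \<open>y\<close> is marked at most
  once, say in direction \<open>\<delta>\<close>; in all other directions the \<open>d\<close> members of \<open>S = T - {y}\<close> already
  impose the constraints of \<open>y\<close> (\<open>exists_element_dominated_off_one_direction\<close>).

  There are only \<open>2 d * (n choose d)\<close> pairs \<open>(S, \<delta>)\<close>, so if a fraction \<open>\<alpha>\<close> of the tuples is
  \<open>P\<close>-intersecting, then some pair arises from linearly many \<open>y\<close>
  (\<open>exists_popular_pair\<close>).  Let \<open>Y\<close> be the set of these \<open>y\<close>, and let \<open>z\<close> be the member of
  \<open>Y\<close> that is most restrictive in direction \<open>\<delta>\<close>.  The intersection of \<open>S\<close> and \<open>z\<close> has property
  \<open>P\<close>, and it lies in every box of \<open>Y\<close>: \<open>z\<close> takes care of the direction \<open>\<delta>\<close> and \<open>S\<close> of the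
  others.  By monotonicity \<open>Y\<close> is \<open>P\<close>-intersecting.
\<close>

section \<open>Boxes as intersections of coordinate halfspaces\<close>

definition signed_coord :: "'n \<times> bool \<Rightarrow> real ^ 'n \<Rightarrow> real" where
  "signed_coord \<delta> x = (if snd \<delta> then x $ fst \<delta> else - (x $ fst \<delta>))"

text \<open>
  Treating lower and upper bounds alike makes ``more restrictive in direction \<open>\<delta>\<close>'' mean a larger
  threshold \<open>r \<delta>\<close>, whatever the sign of the direction.
\<close>
lemma is_box_iff_halfspaces:
  "is_box C \<longleftrightarrow> (\<exists>r. C = {x :: real ^ 'n. \<forall>\<delta>. r \<delta> \<le> signed_coord \<delta> x})"
proof
  assume "is_box C"
  then obtain a b where C: "C = cbox a b"
    unfolding is_box_def by blast
  define r where "r = (\<lambda>\<delta>. if snd \<delta> then a $ fst \<delta> else - (b $ fst \<delta>))"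
  have "(\<forall>\<delta>. r \<delta> \<le> signed_coord \<delta> x) \<longleftrightarrow> x \<in> cbox a b" for x
    by (simp add: r_def mem_box_cart signed_coord_def split_paired_All all_bool_eq conj_commute)
  then show "\<exists>r. C = {x. \<forall>\<delta>. r \<delta> \<le> signed_coord \<delta> x}"
    unfolding C by (intro exI[of _ r]) simp
next
  assume "\<exists>r. C = {x. \<forall>\<delta>. r \<delta> \<le> signed_coord \<delta> x}"
  then obtain r where C: "C = {x. \<forall>\<delta>. r \<delta> \<le> signed_coord \<delta> x}"
    by blast
  have "(\<forall>\<delta>. r \<delta> \<le> signed_coord \<delta> x) \<longleftrightarrow>
      x \<in> cbox (\<chi> k. r (k, True)) (\<chi> k. - r (k, False))" for x
    by (simp add: mem_box_cart signed_coord_def split_paired_All all_bool_eq conj_commute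
        le_minus_iff[of "r _"])
  then show "is_box C"
    unfolding is_box_def C by blast
qed

lemma is_box_INT:
  assumes "finite J" "J \<noteq> {}" "\<And>i. i \<in> J \<Longrightarrow> is_box (B i :: (real ^ 'n) set)"
  shows "is_box (\<Inter>i\<in>J. B i)"
proof -
  have "\<forall>i\<in>J. \<exists>r. B i = {x. \<forall>\<delta>. r \<delta> \<le> signed_coord \<delta> x}"
    using assms(3) by (simp add: is_box_iff_halfspaces)
  then obtain r where r: "\<forall>i\<in>J. B i = {x. \<forall>\<delta>. r i \<delta> \<le> signed_coord \<delta> x}"
    by metis
  have "(\<Inter>i\<in>J. B i) = {x. \<forall>\<delta>. Max ((\<lambda>i. r i \<delta>) ` J) \<le> signed_coord \<delta> x}"
    using assms(1,2) r by auto
  then show ?thesis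
    unfolding is_box_iff_halfspaces
    by (intro exI[of _ "\<lambda>\<delta>. Max ((\<lambda>i. r i \<delta>) ` J)"])
qed

section \<open>Two pigeonhole arguments\<close>

text \<open>
  If each direction marks one maximizing element of \<open>T\<close>, the average number of marks is below two,
  so some \<open>y\<close> has at most one mark; the marked elements of the remaining directions dominate \<open>y\<close>
  there and differ from \<open>y\<close>.
\<close>
lemma exists_element_dominated_off_one_direction:
  fixes r :: "'i \<Rightarrow> 'd::finite \<Rightarrow> 'a::linorder"
  assumes "finite T" and card: "CARD('d) < 2 * card T"
  shows "\<exists>y\<in>T. \<exists>\<delta>. \<forall>\<delta>'. \<delta>' \<noteq> \<delta> \<longrightarrow> (\<exists>x\<in>T - {y}. r y \<delta>' \<le> r x \<delta>')"
proof -
  have "T \<noteq> {}"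
    using card by auto
  have "\<exists>x\<in>T. \<forall>y\<in>T. r y \<delta> \<le> r x \<delta>" for \<delta>
  proof -
    have "Max ((\<lambda>x. r x \<delta>) ` T) \<in> (\<lambda>x. r x \<delta>) ` T"
      using \<open>finite T\<close> \<open>T \<noteq> {}\<close> by (intro Max_in) auto
    then obtain x where "x \<in> T" "r x \<delta> = Max ((\<lambda>x. r x \<delta>) ` T)"
      by (metis imageE)
    with \<open>finite T\<close> show ?thesis
      by (intro bexI[of _ x]) auto
  qed
  then obtain m where m: "\<And>\<delta>. m \<delta> \<in> T" "\<And>\<delta> y. y \<in> T \<Longrightarrow> r y \<delta> \<le> r (m \<delta>) \<delta>"
    by metis
  have "\<exists>y\<in>T. card {\<delta>. m \<delta> = y} \<le> 1"
  proof (rule ccontr)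
    assume "\<not> ?thesis"
    then have "(\<Sum>y\<in>T. 2) \<le> (\<Sum>y\<in>T. card {\<delta>. m \<delta> = y})"
      by (intro sum_mono) (auto simp: not_le)
    also have "\<dots> = card (\<Union>y\<in>T. {\<delta>. m \<delta> = y})"
      using \<open>finite T\<close> by (intro card_UN_disjoint[symmetric]) auto
    also have "\<dots> \<le> CARD('d)"
      by (intro card_mono) auto
    finally show False
      using card by simp
  qed
  then obtain y where y: "y \<in> T" "card {\<delta>. m \<delta> = y} \<le> 1"
    by blast
  then obtain \<delta> where \<delta>: "{\<delta>. m \<delta> = y} \<subseteq> {\<delta>}"
    by (metis card_le_Suc0_iff_eq One_nat_def finite insertCI subsetI subset_empty all_not_in_conv)
  have "\<exists>x\<in>T - {y}. r y \<delta>' \<le> r x \<delta>'" if "\<delta>' \<noteq> \<delta>" for \<delta>'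
    using that \<delta> y(1) m by (intro bexI[of _ "m \<delta>'"]) auto
  with y(1) show ?thesis
    by blast
qed

text \<open>
  Splitting each \<open>T\<close> into a distinguished element \<open>y\<close> and the rest \<open>S\<close>, with label \<open>\<delta>\<close>, loses no
  information, so the sets \<open>T\<close> are distributed over at most \<open>(n choose k) * CARD('d)\<close> pairs
  \<open>(S, \<delta>)\<close>.
\<close>
lemma exists_popular_pair:
  fixes Q :: "'i set \<Rightarrow> 'd::finite \<Rightarrow> 'i \<Rightarrow> bool"
  assumes "finite I" "k \<le> card I"
    and \<T>: "\<And>T. T \<in> \<T> \<Longrightarrow> T \<subseteq> I \<and> card T = Suc k"
    and split: "\<And>T. T \<in> \<T> \<Longrightarrow> \<exists>y\<in>T. \<exists>\<delta>. Q (T - {y}) \<delta> y"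
  shows "\<exists>S \<delta>. card \<T> \<le> ((card I choose k) * CARD('d)) *
    card {y \<in> I. insert y S \<in> \<T> \<and> Q S \<delta> y}"
proof (rule ccontr)
  define Y where "Y = (\<lambda>(S, \<delta>). {y \<in> I. insert y S \<in> \<T> \<and> Q S \<delta> y})"
  define A where "A = {S. S \<subseteq> I \<and> card S = k} \<times> (UNIV :: 'd set)"
  have "finite {S. S \<subseteq> I \<and> card S = k}"
    using \<open>finite I\<close> by simp
  then have "finite A"
    unfolding A_def by simp
  have card_A: "card A = (card I choose k) * CARD('d)"
    unfolding A_def using \<open>finite I\<close> by (simp add: card_cartesian_product n_subsets)
  have finY: "finite (Y p)" for p
    unfolding Y_def using \<open>finite I\<close> by (cases p) auto
  assume "\<not> ?thesis"
  then have less: "card A * card (Y p) < card \<T>" for p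
    by (cases p) (auto simp: Y_def card_A not_le)
  have "\<T> \<subseteq> (\<lambda>(p, y). insert y (fst p)) ` Sigma A Y"
  proof
    fix T assume T: "T \<in> \<T>"
    then obtain y \<delta> where y: "y \<in> T" "Q (T - {y}) \<delta> y"
      using split by blast
    have "T \<subseteq> I" "card T = Suc k"
      using \<T>[OF T] by auto
    then have "((T - {y}, \<delta>), y) \<in> Sigma A Y"
      using y T by (auto simp: A_def Y_def insert_absorb card_Diff_singleton)
    moreover have "T = (\<lambda>(p, y). insert y (fst p)) ((T - {y}, \<delta>), y)"
      using y by auto
    ultimately show "T \<in> (\<lambda>(p, y). insert y (fst p)) ` Sigma A Y"
      by blast
  qed
  then have "card \<T> \<le> card (Sigma A Y)"
    using \<open>finite A\<close> finY by (meson finite_SigmaI surj_card_le)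
  also have "\<dots> = (\<Sum>p\<in>A. card (Y p))"
    using \<open>finite A\<close> finY by simp
  finally have total: "card \<T> \<le> (\<Sum>p\<in>A. card (Y p))" .
  have "0 < card A"
    using \<open>k \<le> card I\<close> by (simp add: card_A)
  then have "A \<noteq> {}"
    by auto
  have "card A * (\<Sum>p\<in>A. card (Y p)) = (\<Sum>p\<in>A. card A * card (Y p))"
    by (simp add: sum_distrib_left)
  also have "\<dots> < (\<Sum>p\<in>A. card \<T>)"
    using \<open>finite A\<close> \<open>A \<noteq> {}\<close> less by (intro sum_strict_mono) auto
  also have "\<dots> = card A * card \<T>"
    by simp
  finally show False
    using total \<open>0 < card A\<close> by simp
qed

section \<open>From a popular pair to a \<open>P\<close>-intersecting subfamily\<close>

text \<open>
  It suffices to find one \<open>P\<close>-intersecting subfamily whose intersection lies in all of the boxes: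
  the member \<open>z\<close> of \<open>Y\<close> with the largest threshold in direction \<open>\<delta>\<close>, together with \<open>S\<close>.
\<close>
lemma P_intersecting_of_popular_pair:
  fixes B :: "'i \<Rightarrow> (real ^ 'n) set"
  assumes P: "monotone_box_property P"
    and "finite S" "finite Y" "Y \<noteq> {}"
    and box: "\<And>i. i \<in> S \<union> Y \<Longrightarrow> B i = {x. \<forall>\<delta>. r i \<delta> \<le> signed_coord \<delta> x}"
    and Y: "\<And>y. y \<in> Y \<Longrightarrow> P_intersecting P B (insert y S)"
    and dom: "\<And>y \<delta>'. y \<in> Y \<Longrightarrow> \<delta>' \<noteq> \<delta> \<Longrightarrow> \<exists>x\<in>S. r y \<delta>' \<le> r x \<delta>'"
  shows "P_intersecting P B Y"
proof -
  have "Max ((\<lambda>y. r y \<delta>) ` Y) \<in> (\<lambda>y. r y \<delta>) ` Y"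
    using \<open>finite Y\<close> \<open>Y \<noteq> {}\<close> by (intro Max_in) auto
  then obtain z where z: "z \<in> Y" and "r z \<delta> = Max ((\<lambda>y. r y \<delta>) ` Y)"
    by (metis imageE)
  then have z_max: "r y \<delta> \<le> r z \<delta>" if "y \<in> Y" for y
    using that \<open>finite Y\<close> by simp
  have is_box: "is_box (B i)" if "i \<in> S \<union> Y" for i
    unfolding is_box_iff_halfspaces using box[OF that] by blast
  have "(\<Inter>i\<in>insert z S. B i) \<subseteq> (\<Inter>y\<in>Y. B y)"
  proof (intro subsetI INT_I)
    fix x y
    assume x: "x \<in> (\<Inter>i\<in>insert z S. B i)" and y: "y \<in> Y"
    have thresholds: "r i \<delta>' \<le> signed_coord \<delta>' x" if "i \<in> insert z S" for i \<delta>'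
    proof -
      have "x \<in> B i" "i \<in> S \<union> Y"
        using x that z by auto
      with box[of i] show ?thesis
        by blast
    qed
    have "r y \<delta>' \<le> signed_coord \<delta>' x" for \<delta>'
    proof (cases "\<delta>' = \<delta>")
      case True
      with z_max[OF y] thresholds[of z \<delta>] show ?thesis
        by simp
    next
      case False
      then obtain s where "s \<in> S" "r y \<delta>' \<le> r s \<delta>'"
        using dom[OF y] by blast
      with thresholds[of s \<delta>'] show ?thesis
        by simp
    qed
    then show "x \<in> B y"
      using box[of y] y by simp
  qed
  moreover have "is_box (\<Inter>i\<in>insert z S. B i)"
    using \<open>finite S\<close> z is_box by (intro is_box_INT) auto
  moreover have "is_box (\<Inter>y\<in>Y. B y)"
    using \<open>finite Y\<close> \<open>Y \<noteq> {}\<close> is_box by (intro is_box_INT) auto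
  moreover have "P (\<Inter>i\<in>insert z S. B i)"
    using Y[OF z] by (simp add: P_intersecting_def)
  ultimately show ?thesis
    using P unfolding monotone_box_property_def P_intersecting_def by blast
qed

text \<open>
  Passing from \<open>(d + 1)\<close>-subsets to \<open>d\<close>-subsets costs the factor \<open>(n - d) / (d + 1)\<close>, which is
  linear in \<open>n\<close> because \<open>n - d \<ge> n / (d + 1)\<close> for \<open>n \<ge> d + 1\<close>.
\<close>
lemma binomial_mult_le_binomial_Suc:
  assumes "n \<ge> Suc d"
  shows "n * (n choose d) \<le> (Suc d)\<^sup>2 * (n choose Suc d)"
proof -
  obtain m where n: "n = Suc d + m"
    using assms le_Suc_ex by blast
  have "n \<le> Suc d * (n - d)"
    by (simp add: n)
  then have "n * (n choose d) \<le> Suc d * ((n - d) * (n choose d))"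
    by (metis mult.assoc mult_le_mono1)
  also have "(n - d) * (n choose d) = Suc d * (n choose Suc d)"
    using binomial_absorb_comp[of n d] binomial_absorption[of d n] by simp
  finally show ?thesis
    by (simp add: power2_eq_square algebra_simps)
qed

theorem theorem1p5:
  fixes \<alpha> :: real
  assumes "\<alpha> > 0"
  shows "\<exists>\<beta>::real. \<beta> > 0 \<and>
    (\<forall>(P :: (real ^ 'n) set \<Rightarrow> bool) (B :: nat \<Rightarrow> (real ^ 'n) set) (I :: nat set).
       monotone_box_property P \<longrightarrow>
       finite I \<longrightarrow> (\<forall>i\<in>I. is_box (B i)) \<longrightarrow>
       card I \<ge> CARD('n) + 1 \<longrightarrow>
       real (card {T. T \<subseteq> I \<and> card T = CARD('n) + 1 \<and> P_intersecting P B T})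
         \<ge> \<alpha> * real (card I choose (CARD('n) + 1)) \<longrightarrow>
       (\<exists>J\<subseteq>I. P_intersecting P B J \<and> real (card J) \<ge> \<beta> * real (card I)))"
proof -
  define d where "d = CARD('n)"
  have "d > 0"
    unfolding d_def by simp
  \<comment> \<open>One factor \<open>2 d\<close> for the choice of \<open>\<delta>\<close>; the square comes from comparing the number of
    \<open>(d + 1)\<close>-tuples with \<open>n\<close> times the number of \<open>d\<close>-tuples.\<close>
  define \<beta> where "\<beta> = \<alpha> / (real (2 * d) * (real (Suc d))\<^sup>2)"
  have "\<beta> > 0"
    unfolding \<beta>_def using \<open>\<alpha> > 0\<close> \<open>d > 0\<close> by simp
  have "\<exists>J\<subseteq>I. P_intersecting P B J \<and> real (card J) \<ge> \<beta> * real (card I)"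
    if P: "monotone_box_property P" and "finite I" and boxes: "\<forall>i\<in>I. is_box (B i)"
      and n: "card I \<ge> Suc d"
      and dense: "real (card {T. T \<subseteq> I \<and> card T = Suc d \<and> P_intersecting P B T})
        \<ge> \<alpha> * real (card I choose Suc d)"
    for P and B :: "nat \<Rightarrow> (real ^ 'n) set" and I
  proof -
    define \<T> where "\<T> = {T. T \<subseteq> I \<and> card T = Suc d \<and> P_intersecting P B T}"
    have "\<forall>i\<in>I. \<exists>r. B i = {x. \<forall>\<delta>. r \<delta> \<le> signed_coord \<delta> x}"
      using boxes by (simp add: is_box_iff_halfspaces)
    then obtain r where r: "\<forall>i\<in>I. B i = {x. \<forall>\<delta>. r i \<delta> \<le> signed_coord \<delta> x}"
      by metis
    \<comment> \<open>\<open>S\<close> imposes all the constraints of \<open>y\<close> except possibly the one in direction \<open>\<delta>\<close>.\<close>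
    define Q where
      "Q = (\<lambda>S \<delta> y. \<forall>\<delta>'. \<delta>' \<noteq> \<delta> \<longrightarrow> (\<exists>x\<in>S. r y \<delta>' \<le> r x \<delta>'))"
    have card_dir: "CARD('n \<times> bool) = 2 * d"
      unfolding d_def by simp
    have "\<exists>S \<delta>. card \<T> \<le> ((card I choose d) * CARD('n \<times> bool)) *
        card {y \<in> I. insert y S \<in> \<T> \<and> Q S \<delta> y}"
    proof (rule exists_popular_pair)
      show "\<exists>y\<in>T. \<exists>\<delta>. Q (T - {y}) \<delta> y" if "T \<in> \<T>" for T
        unfolding Q_def
      proof (rule exists_element_dominated_off_one_direction)
        show "finite T"
          using that \<open>finite I\<close> finite_subset unfolding \<T>_def by blast
        show "CARD('n \<times> bool) < 2 * card T"
          unfolding card_dir using that by (simp add: \<T>_def)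
      qed
    qed (use \<open>finite I\<close> n in \<open>auto simp: \<T>_def\<close>)
    then obtain S \<delta> where
      popular: "card \<T> \<le> ((card I choose d) * (2 * d)) *
        card {y \<in> I. insert y S \<in> \<T> \<and> Q S \<delta> y}"
      unfolding card_dir by blast
    define Y where "Y = {y \<in> I. insert y S \<in> \<T> \<and> Q S \<delta> y}"
    have "Y \<subseteq> I"
      unfolding Y_def by blast
    have "\<alpha> * real (card I * (card I choose d))
        \<le> \<alpha> * real ((Suc d)\<^sup>2 * (card I choose Suc d))"
      using \<open>\<alpha> > 0\<close> binomial_mult_le_binomial_Suc[OF n] by (simp only: of_nat_le_iff mult_le_cancel_left_pos)
    also have "\<dots> = (real (Suc d))\<^sup>2 * (\<alpha> * real (card I choose Suc d))"
      by simp
    also have "\<dots> \<le> (real (Suc d))\<^sup>2 * real (card \<T>)"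
      using dense unfolding \<T>_def by (intro mult_left_mono) auto
    also have "\<dots> \<le> (real (Suc d))\<^sup>2 * real (((card I choose d) * (2 * d)) * card Y)"
      using popular unfolding Y_def by (intro mult_left_mono) (simp_all only: of_nat_le_iff zero_le_power2)
    finally have "real (card I choose d) * (\<alpha> * real (card I))
        \<le> real (card I choose d) * ((real (2 * d) * (real (Suc d))\<^sup>2) * real (card Y))"
      by (simp add: algebra_simps)
    moreover have "0 < real (card I choose d)"
      using n by simp
    ultimately have "\<alpha> * real (card I) \<le> (real (2 * d) * (real (Suc d))\<^sup>2) * real (card Y)"
      by (simp only: mult_le_cancel_left_pos)
    moreover have "0 < real (2 * d) * (real (Suc d))\<^sup>2"
      using \<open>d > 0\<close> by simp
    ultimately have large: "\<beta> * real (card I) \<le> real (card Y)"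
      unfolding \<beta>_def by (simp only: times_divide_eq_left pos_divide_le_eq mult.commute[of "real (card Y)"])
    moreover have "0 < \<beta> * real (card I)"
      using \<open>\<beta> > 0\<close> n by simp
    ultimately have "Y \<noteq> {}"
      by auto
    then have "S \<subseteq> I"
      unfolding Y_def \<T>_def by blast
    have "P_intersecting P B Y"
    proof (rule P_intersecting_of_popular_pair[OF P])
      show "finite S" "finite Y"
        using \<open>S \<subseteq> I\<close> \<open>Y \<subseteq> I\<close> \<open>finite I\<close> finite_subset by blast+
      show "B i = {x. \<forall>\<delta>. r i \<delta> \<le> signed_coord \<delta> x}" if "i \<in> S \<union> Y" for i
        using that r \<open>S \<subseteq> I\<close> \<open>Y \<subseteq> I\<close> by blast
      show "P_intersecting P B (insert y S)" if "y \<in> Y" for y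
        using that unfolding Y_def \<T>_def by blast
      show "\<exists>x\<in>S. r y \<delta>' \<le> r x \<delta>'" if "y \<in> Y" "\<delta>' \<noteq> \<delta>" for y \<delta>'
        using that unfolding Y_def Q_def by blast
    qed fact
    with \<open>Y \<subseteq> I\<close> large show ?thesis
      by blast
  qed
  with \<open>\<beta> > 0\<close> show ?thesis
    unfolding d_def by (intro exI[of _ \<beta>]) simp
qed

end
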